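(* Let $m$ be a doubling measure on a bounded (complete and separable) metric space $(X,d)$, let $\mu=\rho m\in\mathscr{P}(X)$ with $\rho>0$ $m$-a.e. in $X$, and let $\nu\in\mathscr{P}(X)$. Let $\pi\in\mathrm{GeoOpt}(\mu,\nu)$ and let $\varphi\colon X\to\mathbb{R}\cup\{-\infty\}$ be a Kantorovich potential relative to $\pi$ satisfying $$|\nabla_g^+\varphi|(\gamma_0)=d(\gamma_0,\gamma_1)\qquad\text{for }\pi\text{-a.e. }\gamma\in\mathrm{Geo}(X).$$ Assume further that there exists $\bar s\in(0,1]$ such that $(e_s)_\#\pi\ll m$ for all $s\in[0,\bar s)$. Then for $\pi$-a.e. $\gamma\in\mathrm{Geo}(X)$ we have $$\lim_{t\downarrow0}\frac{\varphi(\gamma_0)-\varphi(\gamma_t)}{d(\gamma_0,\gamma_t)}=d(\gamma_0,\gamma_1).$$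
   Context: All metric spaces are complete and separable. A measure on $(X,d)$ is a nonnegative Borel measure that is finite on bounded sets. $\mathscr{P}(X)$ is the set of Borel probability measures on $X$; $\mu=\rho m$ means that $\mu$ is absolutely continuous with respect to $m$ with density $\rho$. The measure $m$ is doubling if there is $0<C<\infty$ such that $m(B(x,2r))\le C\,m(B(x,r))$ for all $x\in X$ and $0<r<\mathrm{diam}(X)$. Geodesics: $\mathrm{Geo}(X)$ is the set of constant speed geodesics, i.e. maps $\gamma\colon[0,1]\to X$ with $d(\gamma_s,\gamma_t)=|t-s|\,d(\gamma_0,\gamma_1)$ for all $s,t\in[0,1]$, where $\gamma_s=\gamma(s)$; it is endowed with the distance $d^*(\gamma,\tilde\gamma)=\max_{t\in[0,1]}d(\gamma_t,\tilde\gamma_t)$. The evaluation map is $e_t\colon\mathrm{Geo}(X)\to X$, $e_t(\gamma)=\gamma_t$. $f_\#\mu$ denotes the push-forward measure. Optimal geodesic plans: $W_2(\mu,\nu)=\left(\inf\int_{X\times X}d^2(x,y)\,d\sigma(x,y)\right)^{1/2}$, the infimum being over all $\sigma\in\mathscr{P}(X\times X)$ with first marginal $\mu$ and second marginal $\nu$. $\mathrm{GeoOpt}(\mu,\nu)$ is the set of Borel probability measures $\pi$ on $\mathrm{Geo}(X)$ with $(e_0)_\#\pi=\mu$, $(e_1)_\#\pi=\nu$ and $\int_{\mathrm{Geo}(X)}d^2(\gamma_0,\gamma_1)\,d\pi(\gamma)=W_2^2(\mu,\nu)<\infty$. Kantorovich potentials: the $c$-transform of $\varphi\colon X\to\mathbb{R}\cup\{-\infty\}$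 is $\varphi^c(x)=\inf_{y\in X}\left\{\frac{d^2(x,y)}{2}-\varphi(y)\right\}$; a function $\psi$ is $c$-concave if $\psi=\varphi^c$ for some function $\varphi$. A Borel function $\varphi\colon X\to\mathbb{R}\cup\{-\infty\}$ is a Kantorovich potential relative to $\pi\in\mathrm{GeoOpt}(\mu,\nu)$ if it is $c$-concave and $\varphi(\gamma_0)+\varphi^c(\gamma_1)=\frac{d^2(\gamma_0,\gamma_1)}{2}$ for $\pi$-a.e. $\gamma\in\mathrm{Geo}(X)$. (On a bounded space such a $\varphi$ is real-valued, so the slope below is defined.) Lower ascending slope along geodesics: for $f\colon X\to\mathbb{R}$ and $x\in X$, $$|\nabla_g^+f|(x)=\sup_\gamma\liminf_{s\downarrow0}\frac{[f(\gamma_s)-f(x)]^+}{d(\gamma_s,x)},$$ where $[\cdot]^+$ is the positive part and the supremum is over all nonconstant (constant speed) geodesics $\gamma$ in $X$ starting from $x$, with value $0$ if there are none. Convention: for constant $\gamma$ the quotient $\frac{0}{0}$ in the conclusion is understood as $0$. *)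

theory Defs
  imports "HOL-Analysis.Analysis" "HOL-Probability.Probability_Measure"
begin

text \<open>A metric space is a type of class \<^class>\<open>metric_space\<close>; complete and separable metric
  spaces are the types of class \<^class>\<open>polish_space\<close>.\<close>

section \<open>The space of constant speed geodesics\<close>

text \<open>Maps \<open>[0,1] \<rightarrow> X\<close> are represented by functions on the reals that are \<open>extensional\<close> on
  \<open>{0..1}\<close>, so that equality of geodesics is equality on \<open>[0,1]\<close>.\<close>

typedef (overloaded) ('a::metric_space) geo =
  "{\<gamma> :: real \<Rightarrow> 'a. \<gamma> \<in> extensional {0..1} \<and>
      (\<forall>s\<in>{0..1}. \<forall>t\<in>{0..1}. dist (\<gamma> s) (\<gamma> t) = \<bar>t - s\<bar> * dist (\<gamma> 0) (\<gamma> 1))}"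
  morphisms geo_fun Abs_geo
proof
  show "restrict (\<lambda>_. undefined) {0..1} \<in> {\<gamma> :: real \<Rightarrow> 'a. \<gamma> \<in> extensional {0..1} \<and>
      (\<forall>s\<in>{0..1}. \<forall>t\<in>{0..1}. dist (\<gamma> s) (\<gamma> t) = \<bar>t - s\<bar> * dist (\<gamma> 0) (\<gamma> 1))}"
    by auto
qed

definition ev :: "real \<Rightarrow> 'a::metric_space geo \<Rightarrow> 'a"
  where "ev t \<gamma> = geo_fun \<gamma> t"

lemma dist_ev:
  assumes "s \<in> {0..1}" "t \<in> {0..1}"
  shows "dist (ev s \<gamma>) (ev t \<gamma>) = \<bar>t - s\<bar> * dist (ev 0 \<gamma>) (ev 1 \<gamma>)"
  using geo_fun[of \<gamma>] assms unfolding ev_def by blast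

lemma continuous_on_ev: "continuous_on {0..1} (\<lambda>t. ev t \<gamma>)"
proof -
  have "(dist (ev 0 \<gamma>) (ev 1 \<gamma>))-lipschitz_on {0..1} (\<lambda>t. ev t \<gamma>)"
  proof (rule lipschitz_onI)
    fix s t :: real
    assume "s \<in> {0..1}" "t \<in> {0..1}"
    then have "dist (ev s \<gamma>) (ev t \<gamma>) = \<bar>t - s\<bar> * dist (ev 0 \<gamma>) (ev 1 \<gamma>)"
      by (rule dist_ev)
    also have "\<dots> = dist (ev 0 \<gamma>) (ev 1 \<gamma>) * dist s t"
      unfolding dist_real_def by (simp only: abs_minus_commute mult.commute)
    finally show "dist (ev s \<gamma>) (ev t \<gamma>) \<le> dist (ev 0 \<gamma>) (ev 1 \<gamma>) * dist s t"
      by simp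
  qed simp
  then show ?thesis
    by (rule lipschitz_on_continuous_on)
qed

lemma geo_eqI:
  assumes "\<And>t. t \<in> {0..1} \<Longrightarrow> ev t \<gamma> = ev t \<eta>"
  shows "\<gamma> = \<eta>"
proof -
  have "geo_fun \<gamma> \<in> extensional {0..1}" "geo_fun \<eta> \<in> extensional {0..1}"
    using geo_fun by auto
  then have "geo_fun \<gamma> = geo_fun \<eta>"
    using assms unfolding ev_def by (intro extensionalityI) auto
  then show ?thesis
    by (simp add: geo_fun_inject)
qed

text \<open>The metric is the uniform distance \<open>d\<^sup>*\<close>; the supremum is a maximum, see
  \<open>dist_geo_attained\<close> below.\<close>

instantiation geo :: (metric_space) metric_space
begin

definition dist_geo :: "'a geo \<Rightarrow> 'a geo \<Rightarrow> real"
  where "dist_geo \<gamma> \<eta> = (SUP t\<in>{0..1}. dist (ev t \<gamma>) (ev t \<eta>))"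

definition uniformity_geo :: "('a geo \<times> 'a geo) filter"
  where "uniformity_geo = (INF e\<in>{0 <..}. principal {(x, y). dist x y < e})"

definition open_geo :: "'a geo set \<Rightarrow> bool"
  where "open_geo U = (\<forall>x\<in>U. \<forall>\<^sub>F (x', y) in uniformity. x' = x \<longrightarrow> y \<in> U)"

lemma dist_geo_attained:
  fixes \<gamma> \<eta> :: "'a geo"
  shows "\<exists>t\<in>{0..1}. dist \<gamma> \<eta> = dist (ev t \<gamma>) (ev t \<eta>)
           \<and> (\<forall>s\<in>{0..1}. dist (ev s \<gamma>) (ev s \<eta>) \<le> dist (ev t \<gamma>) (ev t \<eta>))"
proof -
  have "continuous_on {0..1} (\<lambda>t. dist (ev t \<gamma>) (ev t \<eta>))"
    by (intro continuous_on_dist continuous_on_ev)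
  then obtain t where t: "t \<in> {0..1::real}"
      "\<forall>s\<in>{0..1}. dist (ev s \<gamma>) (ev s \<eta>) \<le> dist (ev t \<gamma>) (ev t \<eta>)"
    using continuous_attains_sup[OF compact_Icc, of 0 1 "\<lambda>t. dist (ev t \<gamma>) (ev t \<eta>)"] by auto
  then have "dist \<gamma> \<eta> = dist (ev t \<gamma>) (ev t \<eta>)"
    unfolding dist_geo_def by (intro cSup_eq_maximum) auto
  with t show ?thesis by blast
qed

lemma dist_ev_le_dist_geo:
  fixes \<gamma> \<eta> :: "'a geo"
  assumes "t \<in> {0..1}"
  shows "dist (ev t \<gamma>) (ev t \<eta>) \<le> dist \<gamma> \<eta>"
  using dist_geo_attained[of \<gamma> \<eta>] assms by metis

instance
proof
  fix x y z :: "'a geo"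
  show "dist x y = 0 \<longleftrightarrow> x = y"
  proof
    assume "dist x y = 0"
    then have "ev t x = ev t y" if "t \<in> {0..1}" for t
      using dist_ev_le_dist_geo[OF that, of x y] by simp
    then show "x = y" by (rule geo_eqI)
  next
    assume "x = y"
    then show "dist x y = 0"
      using dist_geo_attained[of x y] by auto
  qed
  obtain t where t: "t \<in> {0..1}" "dist x y = dist (ev t x) (ev t y)"
    using dist_geo_attained[of x y] by blast
  have "dist (ev t x) (ev t y) \<le> dist (ev t x) (ev t z) + dist (ev t y) (ev t z)"
    by (rule dist_triangle2)
  also have "\<dots> \<le> dist x z + dist y z"
    by (intro add_mono dist_ev_le_dist_geo t)
  finally show "dist x y \<le> dist x z + dist y z"
    using t by simp
qed (rule open_geo_def uniformity_geo_def)+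

end

lemma borel_measurable_ev [measurable]:
  assumes "t \<in> {0..1}"
  shows "ev t \<in> borel_measurable borel"
proof (rule borel_measurable_continuous_onI)
  have "1-lipschitz_on UNIV (ev t :: 'a geo \<Rightarrow> 'a)"
    using dist_ev_le_dist_geo[OF assms] by (intro lipschitz_onI) auto
  then show "continuous_on UNIV (ev t :: 'a geo \<Rightarrow> 'a)"
    by (rule lipschitz_on_continuous_on)
qed

section \<open>Measures\<close>

definition borel_prob :: "'b::topological_space measure set"
  where "borel_prob = {\<mu>. sets \<mu> = sets borel \<and> prob_space \<mu>}"

definition boundedly_finite_borel :: "'a::metric_space measure \<Rightarrow> bool"
  where "boundedly_finite_borel m \<longleftrightarrow>
    sets m = sets borel \<and> (\<forall>A\<in>sets borel. bounded A \<longrightarrow> emeasure m A < \<infinity>)"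

text \<open>\<^const>\<open>diameter\<close> is meaningful only for bounded sets; the premise \<open>bounded UNIV\<close> makes
  the condition \<open>r < diam X\<close> vacuous for unbounded \<open>X\<close>, as it should be.\<close>

definition doubling :: "'a::metric_space measure \<Rightarrow> bool"
  where "doubling m \<longleftrightarrow> (\<exists>C::real. 0 < C \<and>
    (\<forall>x r. 0 < r \<and> (bounded (UNIV :: 'a set) \<longrightarrow> r < diameter (UNIV :: 'a set)) \<longrightarrow>
      emeasure m (ball x (2 * r)) \<le> ennreal C * emeasure m (ball x r)))"

section \<open>Optimal geodesic plans\<close>

definition couplings :: "'a::metric_space measure \<Rightarrow> 'a measure \<Rightarrow> ('a \<times> 'a) measure set"
  where "couplings \<mu> \<nu> = {\<sigma> \<in> borel_prob. distr \<sigma> borel fst = \<mu> \<and> distr \<sigma> borel snd = \<nu>}"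

definition W2 :: "'a::metric_space measure \<Rightarrow> 'a measure \<Rightarrow> ennreal"
  where "W2 \<mu> \<nu> =
    (let c = (INF \<sigma>\<in>couplings \<mu> \<nu>. \<integral>\<^sup>+ p. ennreal ((dist (fst p) (snd p))\<^sup>2) \<partial>\<sigma>)
     in if c = \<infinity> then \<infinity> else ennreal (sqrt (enn2real c)))"

lemma W2_squared:
  "(W2 \<mu> \<nu>)\<^sup>2 = (INF \<sigma>\<in>couplings \<mu> \<nu>. \<integral>\<^sup>+ p. ennreal ((dist (fst p) (snd p))\<^sup>2) \<partial>\<sigma>)"
  (is "_ = ?c")
proof (cases "?c = \<infinity>")
  case True
  then show ?thesis
    by (simp add: W2_def Let_def power2_eq_square ennreal_top_mult)
next
  case False
  then have "(W2 \<mu> \<nu>)\<^sup>2 = ennreal ((sqrt (enn2real ?c))\<^sup>2)"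
    by (simp add: W2_def Let_def ennreal_power)
  also have "\<dots> = ennreal (enn2real ?c)"
    by (simp del: ennreal_enn2real)
  also have "\<dots> = ?c"
    using False by (intro ennreal_enn2real) (simp only: less_top infinity_ennreal_def)
  finally show ?thesis .
qed

definition GeoOpt :: "'a::metric_space measure \<Rightarrow> 'a measure \<Rightarrow> 'a geo measure set"
  where "GeoOpt \<mu> \<nu> = {\<pi> \<in> borel_prob. distr \<pi> borel (ev 0) = \<mu> \<and> distr \<pi> borel (ev 1) = \<nu> \<and>
    (\<integral>\<^sup>+ \<gamma>. ennreal ((dist (ev 0 \<gamma>) (ev 1 \<gamma>))\<^sup>2) \<partial>\<pi>) = (W2 \<mu> \<nu>)\<^sup>2 \<and> (W2 \<mu> \<nu>)\<^sup>2 < \<infinity>}"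

section \<open>Kantorovich potentials\<close>

text \<open>Functions \<open>X \<rightarrow> \<real> \<union> {-\<infinity>}\<close> are \<^typ>\<open>ereal\<close>-valued functions avoiding \<open>\<infinity>\<close>.\<close>

definition c_transform :: "('a::metric_space \<Rightarrow> ereal) \<Rightarrow> 'a \<Rightarrow> ereal"
  where "c_transform \<phi> x = (INF y. ereal ((dist x y)\<^sup>2 / 2) - \<phi> y)"

definition c_concave :: "('a::metric_space \<Rightarrow> ereal) \<Rightarrow> bool"
  where "c_concave \<psi> \<longleftrightarrow> (\<exists>\<phi>. (\<forall>x. \<phi> x \<noteq> \<infinity>) \<and> \<psi> = c_transform \<phi>)"

definition kantorovich_potential :: "'a::metric_space geo measure \<Rightarrow> ('a \<Rightarrow> ereal) \<Rightarrow> bool"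
  where "kantorovich_potential \<pi> \<phi> \<longleftrightarrow>
    (\<forall>x. \<phi> x \<noteq> \<infinity>) \<and> \<phi> \<in> borel_measurable borel \<and> c_concave \<phi> \<and>
    (AE \<gamma> in \<pi>. \<phi> (ev 0 \<gamma>) + c_transform \<phi> (ev 1 \<gamma>) = ereal ((dist (ev 0 \<gamma>) (ev 1 \<gamma>))\<^sup>2 / 2))"

text \<open>On a bounded space potentials are real-valued, so nothing is lost by applying
  \<^const>\<open>real_of_ereal\<close> to them.\<close>

lemma kantorovich_potential_real_valued:
  fixes \<phi> :: "'a::metric_space \<Rightarrow> ereal"
  assumes "bounded (UNIV :: 'a set)" "prob_space \<pi>" "kantorovich_potential \<pi> \<phi>"
  shows "\<bar>\<phi> x\<bar> \<noteq> \<infinity>"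
proof -
  obtain \<psi> where \<phi>: "\<phi> = c_transform \<psi>" and \<psi>: "\<And>y. \<psi> y \<noteq> \<infinity>"
    using assms(3) unfolding kantorovich_potential_def c_concave_def by blast
  have fin: "\<phi> z \<noteq> \<infinity>" for z
    using assms(3) unfolding kantorovich_potential_def by blast
  interpret prob_space \<pi> by fact
  have "\<exists>\<gamma>. \<phi> (ev 0 \<gamma>) + c_transform \<phi> (ev 1 \<gamma>) = ereal ((dist (ev 0 \<gamma>) (ev 1 \<gamma>))\<^sup>2 / 2)"
  proof (rule ccontr)
    assume "\<nexists>\<gamma>. \<phi> (ev 0 \<gamma>) + c_transform \<phi> (ev 1 \<gamma>) = ereal ((dist (ev 0 \<gamma>) (ev 1 \<gamma>))\<^sup>2 / 2)"
    then have "AE \<gamma> in \<pi>. False"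
      using assms(3) unfolding kantorovich_potential_def by simp
    then show False by simp
  qed
  then obtain \<gamma> where "\<phi> (ev 0 \<gamma>) + c_transform \<phi> (ev 1 \<gamma>)
      = ereal ((dist (ev 0 \<gamma>) (ev 1 \<gamma>))\<^sup>2 / 2)" ..
  then obtain a b where ab: "\<phi> a + c_transform \<phi> b = ereal ((dist a b)\<^sup>2 / 2)" by (rule that)
  then have a: "\<phi> a \<noteq> -\<infinity>"
    by (cases "c_transform \<phi> b") auto
  obtain D where D: "\<And>u v :: 'a. dist u v \<le> D"
    using assms(1) unfolding bounded_two_points by blast
  have D2: "(dist u v)\<^sup>2 / 2 \<le> (dist x' v)\<^sup>2 / 2 + D\<^sup>2 / 2" for u v x' :: 'a
  proof -
    have "(dist u v)\<^sup>2 \<le> D\<^sup>2" by (intro power_mono D) simp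
    moreover have "0 \<le> (dist x' v)\<^sup>2" by simp
    ultimately show ?thesis by linarith
  qed
  have "\<phi> a \<le> \<phi> x + ereal (D\<^sup>2 / 2)"
  proof -
    have "\<phi> a - ereal (D\<^sup>2 / 2) \<le> ereal ((dist x y)\<^sup>2 / 2) - \<psi> y" for y
    proof -
      have "\<phi> a \<le> ereal ((dist a y)\<^sup>2 / 2) - \<psi> y"
        unfolding \<phi> c_transform_def by (intro INF_lower) simp
      moreover have "\<psi> y \<noteq> \<infinity>" by fact
      ultimately show ?thesis
        using D2[of a y x] by (cases "\<psi> y"; cases "\<phi> a") auto
    qed
    then have "\<phi> a - ereal (D\<^sup>2 / 2) \<le> \<phi> x"
      unfolding \<phi> c_transform_def[of \<psi> x] by (intro INF_greatest)
    then show ?thesis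
      by (cases "\<phi> a"; cases "\<phi> x") auto
  qed
  then show ?thesis
    using a fin[of x] fin[of a] by (cases "\<phi> x"; cases "\<phi> a") auto
qed

text \<open>The supremum is taken in \<^typ>\<open>ennreal\<close>, where the supremum of the empty set is \<open>0\<close>.
  For a nonconstant geodesic the denominator is nonzero for every \<open>s \<in> (0,1]\<close>.\<close>

definition asc_slope_geo :: "('a::metric_space \<Rightarrow> real) \<Rightarrow> 'a \<Rightarrow> ennreal"
  where "asc_slope_geo f x =
    (SUP \<gamma> \<in> {\<gamma>. ev 0 \<gamma> = x \<and> ev 0 \<gamma> \<noteq> ev 1 \<gamma>}.
       Liminf (at_right 0) (\<lambda>s. ennreal (max 0 (f (ev s \<gamma>) - f x) / dist (ev s \<gamma>) x)))"

end

theory Submission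
  imports Defs "HOL-Analysis.Regularity"
begin

text \<open>
  Let \<open>x = \<gamma>\<^sub>0\<close> and \<open>D = d(\<gamma>\<^sub>0,\<gamma>\<^sub>1)\<close>. Comparing the value of the potential at \<open>\<gamma>\<^sub>t\<close> with that at \<open>x\<close>
  through \<open>\<gamma>\<^sub>1\<close> bounds the quotient from below by \<open>D (1 - t/2)\<close>.

  For the upper bound, the slope condition is only needed to know that \<open>d(\<gamma>\<^sub>0,\<gamma>\<^sub>1) = g(\<gamma>\<^sub>0)\<close> for a
  function \<open>g\<close> on \<open>X\<close>. Since the space of geodesics is Polish, \<open>\<pi>\<close> is exhausted by compact sets \<open>C\<close>
  of good geodesics, and \<open>g\<close> is continuous on the compact set \<open>K = e\<^sub>0(C)\<close>. By the doubling property
  \<open>K\<close> is porous only at an \<open>m\<close>-null set of its points. At the other points \<open>x\<close> there is \<open>\<eta> \<in> C\<close> with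
  \<open>d(\<eta>\<^sub>0,\<gamma>\<^sub>t) = o(t)\<close>; the comparison through \<open>\<eta>\<^sub>1\<close> gives
  \<open>\<phi>(x) - \<phi>(\<eta>\<^sub>0) \<le> (d(x,\<eta>\<^sub>1)\<^sup>2 - d(\<eta>\<^sub>0,\<eta>\<^sub>1)\<^sup>2)/2 \<le> d(x,\<eta>\<^sub>0) (g(\<eta>\<^sub>0) + d(x,\<eta>\<^sub>0)/2)\<close>,
  where \<open>g(\<eta>\<^sub>0) \<rightarrow> g(x) = D\<close>, and \<open>\<phi>\<close> is Lipschitz because \<open>X\<close> is bounded.
\<close>

section \<open>The space of geodesics is Polish\<close>

text \<open>Evaluations of a Cauchy sequence are Cauchy at each time, and the geodesic identity
  survives pointwise limits, so the limit map is again a geodesic. Convergence is uniform: at a time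
  where the distance to the limit is attained, the Cauchy bound \<open>e / 2\<close> passes to the
  limit in \<open>m\<close>, with a threshold \<open>M\<close> independent of that time.\<close>

instance geo :: (complete_space) complete_space
proof
  fix X :: "nat \<Rightarrow> 'a geo"
  assume X: "Cauchy X"
  have "convergent (\<lambda>n. ev t (X n))" if "t \<in> {0..1}" for t
  proof -
    have "Cauchy (\<lambda>n. ev t (X n))"
    proof (rule metric_CauchyI)
      fix e :: real assume "0 < e"
      with X obtain M where "\<forall>m\<ge>M. \<forall>n\<ge>M. dist (X m) (X n) < e"
        using metric_CauchyD by blast
      then show "\<exists>M. \<forall>m\<ge>M. \<forall>n\<ge>M. dist (ev t (X m)) (ev t (X n)) < e"
        using dist_ev_le_dist_geo[OF that] by (meson le_less_trans)
    qed
    then show ?thesis by (simp add: Cauchy_convergent_iff)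
  qed
  then obtain l where l: "\<And>t. t \<in> {0..1} \<Longrightarrow> (\<lambda>n. ev t (X n)) \<longlonglongrightarrow> l t"
    unfolding convergent_def by metis
  define \<gamma> where "\<gamma> = Abs_geo (restrict l {0..1})"
  have dl: "dist (l s) (l t) = \<bar>t - s\<bar> * dist (l 0) (l 1)" if "s \<in> {0..1}" "t \<in> {0..1}" for s t
  proof (rule LIMSEQ_unique)
    show "(\<lambda>n. dist (ev s (X n)) (ev t (X n))) \<longlonglongrightarrow> dist (l s) (l t)"
      by (intro tendsto_dist l that)
    show "(\<lambda>n. dist (ev s (X n)) (ev t (X n))) \<longlonglongrightarrow> \<bar>t - s\<bar> * dist (l 0) (l 1)"
      unfolding dist_ev[OF that] by (intro tendsto_mult tendsto_const tendsto_dist l) auto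
  qed
  have "\<forall>s\<in>{0..1}. \<forall>t\<in>{0..1}. dist (restrict l {0..1} s) (restrict l {0..1} t)
      = \<bar>t - s\<bar> * dist (restrict l {0..1} 0) (restrict l {0..1} 1)"
  proof (intro ballI)
    fix s t :: real assume "s \<in> {0..1}" "t \<in> {0..1}"
    with dl[of s t] show "dist (restrict l {0..1} s) (restrict l {0..1} t)
        = \<bar>t - s\<bar> * dist (restrict l {0..1} 0) (restrict l {0..1} 1)" by simp
  qed
  then have "geo_fun \<gamma> = restrict l {0..1}"
    unfolding \<gamma>_def by (intro Abs_geo_inverse CollectI conjI restrict_extensional)
  then have \<gamma>: "ev t \<gamma> = l t" if "t \<in> {0..1}" for t
    using that by (simp add: ev_def)
  have "X \<longlonglongrightarrow> \<gamma>"
  proof (rule metric_LIMSEQ_I)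
    fix e :: real assume "0 < e"
    then obtain M where M: "\<And>m n. m \<ge> M \<Longrightarrow> n \<ge> M \<Longrightarrow> dist (X m) (X n) < e / 2"
      using X metric_CauchyD[of X "e / 2"] by auto
    have "dist (X n) \<gamma> < e" if "n \<ge> M" for n
    proof -
      obtain t where t: "t \<in> {0..1}" "dist (X n) \<gamma> = dist (ev t (X n)) (ev t \<gamma>)"
        using dist_geo_attained[of "X n" \<gamma>] by blast
      have "(\<lambda>m. dist (ev t (X n)) (ev t (X m))) \<longlonglongrightarrow> dist (ev t (X n)) (ev t \<gamma>)"
        using l[OF t(1)] \<gamma>[OF t(1)] by (intro tendsto_dist) auto
      moreover have "dist (ev t (X n)) (ev t (X m)) \<le> e / 2" if "m \<ge> M" for m
        using dist_ev_le_dist_geo[OF t(1), of "X n" "X m"] M[OF \<open>n \<ge> M\<close> that] by linarith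
      ultimately have "dist (ev t (X n)) (ev t \<gamma>) \<le> e / 2"
        by (blast intro: LIMSEQ_le_const2)
      with t \<open>0 < e\<close> show ?thesis by simp
    qed
    then show "\<exists>M. \<forall>n\<ge>M. dist (X n) \<gamma> < e" by blast
  qed
  then show "convergent X" by (rule convergentI)
qed

text \<open>Each geodesic is Lipschitz with its length as constant, so values on a grid of mesh
  \<open>1 / N\<close> control the uniform distance. Closeness of the end points bounds the length
  of \<eta> by \<open>D + 2 * \<delta>\<close>; thus the estimate involves the length of \<gamma>
  alone, and \<open>N\<close> can be fixed before \<eta>.\<close>

lemma dist_geo_le_grid:
  fixes \<gamma> \<eta> :: "'a::metric_space geo" and N :: nat
  assumes N: "0 < N" and le: "\<And>i. i \<le> N \<Longrightarrow> dist (ev (i / N) \<gamma>) (ev (i / N) \<eta>) \<le> \<delta>"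
  shows "dist \<gamma> \<eta> \<le> \<delta> + 2 * (dist (ev 0 \<gamma>) (ev 1 \<gamma>) + \<delta>) / N"
proof -
  define D where "D = dist (ev 0 \<gamma>) (ev 1 \<gamma>)"
  define D' where "D' = dist (ev 0 \<eta>) (ev 1 \<eta>)"
  obtain t where t: "t \<in> {0..1}" "dist \<gamma> \<eta> = dist (ev t \<gamma>) (ev t \<eta>)"
    using dist_geo_attained[of \<gamma> \<eta>] by blast
  have D': "D' \<le> D + 2 * \<delta>"
    using le[of 0] le[of N] N dist_triangle[of "ev 0 \<eta>" "ev 1 \<eta>" "ev 0 \<gamma>"]
      dist_triangle[of "ev 0 \<gamma>" "ev 1 \<eta>" "ev 1 \<gamma>"]
    unfolding D_def D'_def by (simp add: dist_commute)
  define i where "i = nat \<lfloor>t * N\<rfloor>"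
  have "real i \<le> t * N" "t * N < real i + 1"
    using t N unfolding i_def by (auto simp: of_nat_nat)
  moreover have "t * N \<le> N" using t N by (simp add: mult_le_cancel_right1)
  ultimately have "real i \<le> N" "\<bar>(t * N - i) / N\<bar> \<le> 1 / N"
    using N by (linarith, simp add: divide_right_mono)
  moreover have "(t * N - i) / N = t - i / N"
    using N by (simp add: diff_divide_distrib)
  ultimately have i: "i \<le> N" "\<bar>t - i / N\<bar> \<le> 1 / N"
    by auto
  have q: "i / N \<in> {0..1}" using i N by auto
  have "dist \<gamma> \<eta> \<le> dist (ev t \<gamma>) (ev (i / N) \<gamma>) + dist (ev (i / N) \<gamma>) (ev (i / N) \<eta>)
      + dist (ev (i / N) \<eta>) (ev t \<eta>)"
    unfolding t using dist_triangle[of "ev t \<gamma>" "ev t \<eta>" "ev (i / N) \<gamma>"]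
      dist_triangle[of "ev (i / N) \<gamma>" "ev t \<eta>" "ev (i / N) \<eta>"] by linarith
  also have "\<dots> \<le> \<bar>t - i / N\<bar> * D + \<delta> + \<bar>t - i / N\<bar> * D'"
    using dist_ev[OF t(1) q, of \<gamma>] dist_ev[OF q t(1), of \<eta>] le[OF i(1)]
    unfolding D_def D'_def by (simp add: abs_minus_commute)
  also have "\<dots> = \<delta> + \<bar>t - i / N\<bar> * (D + D')" by (simp add: algebra_simps)
  also have "\<dots> \<le> \<delta> + (1 / N) * (2 * (D + \<delta>))"
    using i D' by (intro add_left_mono mult_mono) (auto simp: D_def D'_def)
  finally show ?thesis unfolding D_def by simp
qed

text \<open>The countable base consists of the cylinder sets: finitely many rational times, each
  with a basic open set of X as constraint.\<close>

instance geo :: ("{metric_space, second_countable_topology}") second_countable_topology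
proof
  obtain B :: "'a set set" where B: "countable B" "topological_basis B"
    using ex_countable_basis by blast
  define Q where "Q = (\<rat> :: real set) \<inter> {0..1}"
  define U where "U F = {\<gamma> :: 'a geo. \<forall>(q, b) \<in> F. ev q \<gamma> \<in> b}" for F
  define \<B> where "\<B> = U ` {F. F \<subseteq> Q \<times> B \<and> finite F}"
  have "countable (Q \<times> B)"
    unfolding Q_def using B countable_rat by (intro countable_SIGMA) auto
  then have "countable \<B>"
    unfolding \<B>_def using countable_Collect_finite_subset[of "Q \<times> B"]
    by (intro countable_image) (simp add: conj_commute)
  moreover have "topological_basis \<B>"
  proof (rule topological_basisI)
    fix V assume "V \<in> \<B>"
    then obtain F where F: "V = U F" "F \<subseteq> Q \<times> B" "finite F" unfolding \<B>_def by auto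
    have "open (ev q -` b :: 'a geo set)" if "(q, b) \<in> F" for q b
    proof (rule open_vimage)
      have q: "q \<in> {0..1}" and "b \<in> B" using that F by (auto simp: Q_def)
      then show "open b" using B topological_basis_open by metis
      have "1-lipschitz_on UNIV (ev q :: 'a geo \<Rightarrow> 'a)"
        using dist_ev_le_dist_geo[OF q] by (intro lipschitz_onI) auto
      then show "continuous_on UNIV (ev q :: 'a geo \<Rightarrow> 'a)" by (rule lipschitz_on_continuous_on)
    qed
    then have "open (\<Inter>p\<in>F. ev (fst p) -` snd p :: 'a geo set)"
      using F by (intro open_INT) auto
    also have "(\<Inter>p\<in>F. ev (fst p) -` snd p) = V" unfolding F U_def by auto
    finally show "open V" .
  next
    fix W :: "'a geo set" and \<gamma>
    assume W: "open W" "\<gamma> \<in> W"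
    then obtain e where e: "0 < e" "ball \<gamma> e \<subseteq> W" by (auto simp: open_contains_ball)
    define D where "D = dist (ev 0 \<gamma>) (ev 1 \<gamma>)"
    \<comment> \<open>With \<open>\<delta> = e / 4\<close>, this \<open>N\<close> makes the grid
      error term smaller than \<open>e / 2\<close>.\<close>
    obtain N :: nat where N: "4 * (D + e / 4) / e < N" using reals_Archimedean2 by blast
    have "0 \<le> 4 * (D + e / 4) / e" using e unfolding D_def by simp
    with N have N0: "0 < N" using of_nat_0_less_iff[where 'a=real] by linarith
    have "\<exists>b\<in>B. ev (i / N) \<gamma> \<in> b \<and> b \<subseteq> ball (ev (i / N) \<gamma>) (e / 4)" for i :: nat
      using topological_basisE[OF B(2), of "ball (ev (i / N) \<gamma>) (e / 4)" "ev (i / N) \<gamma>"] e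
      by (metis centre_in_ball open_ball zero_less_divide_iff zero_less_numeral)
    then obtain b where b: "\<And>i. b i \<in> B" "\<And>i. ev (i / N) \<gamma> \<in> b i"
        "\<And>i::nat. b i \<subseteq> ball (ev (i / N) \<gamma>) (e / 4)" by metis
    define F where "F = (\<lambda>i::nat. (i / N, b i)) ` {..N}"
    have "U F \<in> \<B>" unfolding \<B>_def F_def Q_def using b N0 by auto
    moreover have "\<gamma> \<in> U F" using b by (auto simp: U_def F_def)
    moreover have "U F \<subseteq> W"
    proof
      fix \<eta> assume \<eta>: "\<eta> \<in> U F"
      have "dist (ev (i / N) \<gamma>) (ev (i / N) \<eta>) \<le> e / 4" if "i \<le> N" for i
        using \<eta> b(3)[of i] that by (fastforce simp: U_def F_def)
      then have "dist \<gamma> \<eta> \<le> e / 4 + 2 * (D + e / 4) / N"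
        unfolding D_def by (rule dist_geo_le_grid[OF N0])
      also have "2 * (D + e / 4) / N < 3 * e / 4"
      proof -
        have "0 < e * N" using e N0 by simp
        moreover have "4 * (D + e / 4) < e * N" using N e by (simp add: field_simps)
        ultimately show ?thesis using N0 by (simp add: field_simps)
      qed
      finally have "\<eta> \<in> ball \<gamma> e" by simp
      with e show "\<eta> \<in> W" by blast
    qed
    ultimately show "\<exists>B'\<in>\<B>. \<gamma> \<in> B' \<and> B' \<subseteq> W" by blast
  qed
  ultimately show "\<exists>B :: 'a geo set set. countable B \<and> open = generate_topology B"
    using topological_basis_imp_subbasis by blast
qed

instance geo :: (polish_space) polish_space ..

section \<open>Porous sets are null for doubling measures\<close>

text \<open>Greedy selection: keep a ball of largest radius, drop all balls meeting it, and recurse.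
  A dropped ball meets a kept one of at least its own radius, hence lies in the threefold
  enlargement.\<close>

lemma finite_Vitali_covering:
  fixes c :: "'i \<Rightarrow> 'a::metric_space" and r :: "'i \<Rightarrow> real"
  assumes "finite I"
  shows "\<exists>J\<subseteq>I. disjoint_family_on (\<lambda>j. ball (c j) (r j)) J
           \<and> (\<forall>i\<in>I. \<exists>j\<in>J. ball (c i) (r i) \<subseteq> ball (c j) (3 * r j))"
  using assms
proof (induction rule: finite_psubset_induct)
  case (psubset I)
  show ?case
  proof (cases "I = {}")
    case False
    then have "Max (r ` I) \<in> r ` I" using psubset.hyps by (intro Max_in) auto
    then obtain k where k: "k \<in> I" "r k = Max (r ` I)" by auto
    then have k_max: "r i \<le> r k" if "i \<in> I" for i using psubset.hyps that by simp
    \<comment> \<open>The index \<open>k\<close> is removed explicitly: with a nonpositive radius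
      its ball is empty, hence disjoint from itself, and \<open>I'\<close> might fail to
      shrink.\<close>
    define I' where "I' = {i \<in> I - {k}. ball (c i) (r i) \<inter> ball (c k) (r k) = {}}"
    have "I' \<subset> I" unfolding I'_def using k by blast
    from psubset.IH[OF this] obtain J where J: "J \<subseteq> I'"
        "disjoint_family_on (\<lambda>j. ball (c j) (r j)) J"
        "\<forall>i\<in>I'. \<exists>j\<in>J. ball (c i) (r i) \<subseteq> ball (c j) (3 * r j)" by blast
    have "ball (c i) (r i) \<subseteq> ball (c k) (3 * r k)" if i: "i \<in> I - I'" for i
    proof (cases "i = k")
      case True
      show ?thesis
      proof
        fix x assume "x \<in> ball (c i) (r i)"
        with True have "dist (c k) x < r k" by simp
        with zero_le_dist[of "c k" x] have "dist (c k) x < 3 * r k" by linarith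
        then show "x \<in> ball (c k) (3 * r k)" by simp
      qed
    next
      case False
      then obtain y where y: "y \<in> ball (c i) (r i)" "y \<in> ball (c k) (r k)"
        using i unfolding I'_def by blast
      show ?thesis
      proof
        fix x assume "x \<in> ball (c i) (r i)"
        moreover have "dist (c k) x \<le> dist (c k) y + (dist (c i) y + dist (c i) x)"
          by (metis add_left_mono dist_commute dist_triangle order_trans)
        ultimately show "x \<in> ball (c k) (3 * r k)"
          using y k_max[of i] i by auto
      qed
    qed
    moreover have "disjoint_family_on (\<lambda>j. ball (c j) (r j)) (insert k J)"
      using J unfolding I'_def disjoint_family_on_def by blast
    ultimately show ?thesis
      using J k unfolding I'_def by (intro exI[of _ "insert k J"]) blast
  qed (auto simp: disjoint_family_on_def)
qed

lemma doubling_measureE: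
  fixes m :: "'a::metric_space measure"
  assumes "finite_measure m" "doubling m"
  obtains C R :: real where "0 < C" "0 < R"
    "\<And>x r. 0 < r \<Longrightarrow> r < R \<Longrightarrow> measure m (ball x (2 * r)) \<le> C * measure m (ball x r)"
proof (cases "bounded (UNIV :: 'a set) \<and> diameter (UNIV :: 'a set) = 0")
  case True
  \<comment> \<open>In a one-point space no radius lies below the diameter, so the doubling
    condition says nothing; but all balls of positive radius coincide.\<close>
  then have "x = y" for x y :: 'a
    using diameter_bounded_bound[of UNIV x y] by simp
  then have "ball x (2 * r) = ball x r" if "0 < r" for x :: 'a and r :: real
    using that by (metis UNIV_eq_I centre_in_ball mult_pos_pos zero_less_numeral)
  then show thesis by (intro that[of 1 1]) auto
next
  case False
  interpret finite_measure m by fact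
  obtain C where C: "0 < C" "\<And>x r. 0 < r \<Longrightarrow> (bounded (UNIV :: 'a set) \<Longrightarrow> r < diameter (UNIV :: 'a set)) \<Longrightarrow>
      emeasure m (ball x (2 * r)) \<le> ennreal C * emeasure m (ball x r)"
    using assms(2) unfolding doubling_def by blast
  define R where "R = (if bounded (UNIV :: 'a set) then diameter (UNIV :: 'a set) else 1)"
  have "0 < R"
    using False diameter_ge_0[of "UNIV :: 'a set"] unfolding R_def by auto
  moreover have "measure m (ball x (2 * r)) \<le> C * measure m (ball x r)" if "0 < r" "r < R" for x r
  proof -
    have "emeasure m (ball x (2 * r)) \<le> ennreal C * emeasure m (ball x r)"
      using that by (intro C(2)) (auto simp: R_def)
    then show ?thesis
      using C(1) by (simp add: emeasure_eq_measure ennreal_mult' [symmetric])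
  qed
  ultimately show thesis using C(1) that by blast
qed

lemma doubling_iterate:
  fixes m :: "'a::metric_space measure"
  assumes C: "0 \<le> C" and doubl: "\<And>x r. 0 < r \<Longrightarrow> r < R \<Longrightarrow> measure m (ball x (2 * r)) \<le> C * measure m (ball x r)"
    and r: "0 < r" "2 ^ k * r < R"
  shows "measure m (ball x (2 ^ k * r)) \<le> C ^ k * measure m (ball x r)"
  using r
proof (induction k)
  case (Suc k)
  have "0 < 2 ^ k * r" using Suc.prems by simp
  then have *: "2 ^ k * r < R" using Suc.prems(2) unfolding power_Suc by linarith
  have "measure m (ball x (2 * (2 ^ k * r))) \<le> C * measure m (ball x (2 ^ k * r))"
    by (rule doubl) fact+
  also have "\<dots> \<le> C * (C ^ k * measure m (ball x r))"
    using Suc.IH[OF Suc.prems(1) *] C by (rule mult_left_mono)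
  finally show ?case by (simp add: mult.assoc)
qed simp

text \<open>Enclose E in an open U with \<open>m(U - E)\<close> at most \<delta>. Every point of E
  has nearby a hole of comparable size inside \<open>U - E\<close>. A Vitali selection gives
  disjoint balls, hence disjoint holes, whose enlargements cover E; doubling bounds each enlargement
  by a fixed multiple of its hole. So \<open>m(E)\<close> is at most that multiple of
  \<delta>.\<close>

lemma porous_compact_null:
  fixes m :: "'a::polish_space measure"
  assumes m: "sets m = sets borel" "finite_measure m" "doubling m"
    and E: "compact E" and \<epsilon>: "0 < \<epsilon>"
    and porous: "\<And>x r0. x \<in> E \<Longrightarrow> 0 < r0 \<Longrightarrow>
      \<exists>r z. 0 < r \<and> r < r0 \<and> dist x z < r \<and> ball z (\<epsilon> * r) \<inter> E = {}"
  shows "emeasure m E = 0"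
proof -
  interpret finite_measure m by fact
  have fin: "emeasure m (space m) \<noteq> \<infinity>" by simp
  have sets_m: "A \<in> sets m" if "A \<in> sets borel" for A using that m by simp
  have E_sets: "E \<in> sets m" using E m(1) by (simp add: borel_compact)
  obtain C R where C: "0 < C" and R: "0 < R" and doubl:
    "\<And>x r. 0 < r \<Longrightarrow> r < R \<Longrightarrow> measure m (ball x (2 * r)) \<le> C * measure m (ball x r)"
    using doubling_measureE[OF m(2,3)] by blast
  \<comment> \<open>The Vitali enlargement has radius \<open>6 * r\<close> about a point at distance
    less than \<open>r\<close> from the hole's centre, so radius \<open>7 * r\<close> about that
    centre suffices; \<open>k\<close> halvings bring it below \<open>\<epsilon> * r\<close>.\<close>
  obtain k :: nat where k: "7 / \<epsilon> < 2 ^ k"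
    using real_arch_pow[of 2] by auto
  have "measure m E \<le> C ^ k * \<delta>" if "0 < \<delta>" for \<delta>
  proof -
    have "(INF U \<in> {U. E \<subseteq> U \<and> open U}. emeasure m U) < emeasure m E + ennreal \<delta>"
      unfolding outer_regular[OF m(1) fin E_sets[unfolded m(1)], symmetric]
      using that by (simp add: emeasure_eq_measure ennreal_less_iff flip: ennreal_plus)
    then obtain U where U: "E \<subseteq> U" "open U" "emeasure m U < emeasure m E + ennreal \<delta>"
      unfolding INF_less_iff by blast
    then have "measure m U < measure m E + \<delta>"
      using that by (simp add: emeasure_eq_measure ennreal_less_iff flip: ennreal_plus)
    then have UE: "measure m (U - E) \<le> \<delta>"
      using finite_measure_Diff[of U E] E_sets U sets_m by simp
    \<comment> \<open>The bound \<open>7 * r < R\<close> keeps all \<open>k\<close> doublings in the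
      admissible range; the inclusion in \<open>U\<close> places the hole in
      \<open>U - E\<close>.\<close>
    have "\<exists>r z. 0 < r \<and> 7 * r < R \<and> ball x (2 * r) \<subseteq> U \<and> dist x z < r \<and> ball z (\<epsilon> * r) \<inter> E = {}"
      if x: "x \<in> E" for x
    proof -
      obtain s where s: "0 < s" "ball x s \<subseteq> U"
        using U x open_contains_ball by blast
      then have "0 < min (s / 2) (R / 7)" using R by simp
      then obtain r z where rz: "0 < r" "r < min (s / 2) (R / 7)" "dist x z < r" "ball z (\<epsilon> * r) \<inter> E = {}"
        using porous[OF x] by meson
      then have "ball x (2 * r) \<subseteq> U" using s subset_ball[of "2 * r" s x] by auto
      with rz show ?thesis by (intro exI[of _ r] exI[of _ z]) auto
    qed
    then obtain r z where r: "\<And>x. x \<in> E \<Longrightarrow> 0 < r x" "\<And>x. x \<in> E \<Longrightarrow> 7 * r x < R"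
      and rU: "\<And>x. x \<in> E \<Longrightarrow> ball x (2 * r x) \<subseteq> U"
      and z: "\<And>x. x \<in> E \<Longrightarrow> dist x (z x) < r x" "\<And>x. x \<in> E \<Longrightarrow> ball (z x) (\<epsilon> * r x) \<inter> E = {}"
      by metis
    have "E \<subseteq> (\<Union>x\<in>E. ball x (2 * r x))" using r by fastforce
    then obtain F where F: "F \<subseteq> E" "finite F" "E \<subseteq> (\<Union>x\<in>F. ball x (2 * r x))"
      using compactE_image[OF E, of E "\<lambda>x. ball x (2 * r x)"] by auto
    obtain J where J: "J \<subseteq> F" "disjoint_family_on (\<lambda>x. ball x (2 * r x)) J"
        "\<And>x. x \<in> F \<Longrightarrow> \<exists>j\<in>J. ball x (2 * r x) \<subseteq> ball j (3 * (2 * r j))"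
      using finite_Vitali_covering[OF F(2), of "\<lambda>x. x" "\<lambda>x. 2 * r x"] by blast
    have JE: "J \<subseteq> E" and fJ: "finite J" using J F by (auto intro: finite_subset)
    have hole: "ball (z x) (\<epsilon> * r x) \<subseteq> ball x (2 * r x) \<inter> (U - E)" if "x \<in> E" for x
    proof -
      \<comment> \<open>Since \<open>x\<close> is in \<open>E\<close>, it lies outside the hole,
        although its distance to the centre is below \<open>r x\<close>. Hence the hole is smaller
        than \<open>r x\<close> and fits into the selected ball, which makes the holes
        disjoint.\<close>
      have "x \<notin> ball (z x) (\<epsilon> * r x)" using z(2)[OF that] that by blast
      then have "\<epsilon> * r x < r x" using z(1)[OF that] by (simp add: dist_commute)
      have "ball (z x) (\<epsilon> * r x) \<subseteq> ball x (2 * r x)"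
      proof
        fix y assume "y \<in> ball (z x) (\<epsilon> * r x)"
        then show "y \<in> ball x (2 * r x)"
          using dist_triangle[of x y "z x"] z(1)[OF that] \<open>\<epsilon> * r x < r x\<close> by simp
      qed
      then show ?thesis using z(2)[OF that] rU[OF that] by blast
    qed
    have "E \<subseteq> (\<Union>x\<in>J. ball (z x) (7 * r x))"
    proof
      fix y assume "y \<in> E"
      then obtain j where j: "j \<in> J" "y \<in> ball j (3 * (2 * r j))" using F J(3) by blast
      then have "dist (z j) y < 7 * r j"
        using dist_triangle[of "z j" y j] z(1)[of j] JE by (auto simp: dist_commute)
      with j show "y \<in> (\<Union>x\<in>J. ball (z x) (7 * r x))" by auto
    qed
    then have "measure m E \<le> measure m (\<Union>x\<in>J. ball (z x) (7 * r x))"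
      by (intro finite_measure_mono) (auto intro!: sets_m borel_open)
    also have "\<dots> \<le> (\<Sum>x\<in>J. measure m (ball (z x) (7 * r x)))"
      using fJ by (intro measure_UNION_le) (auto intro!: sets_m)
    also have "\<dots> \<le> (\<Sum>x\<in>J. C ^ k * measure m (ball (z x) (\<epsilon> * r x)))"
    proof (rule sum_mono)
      fix x assume "x \<in> J"
      then have x: "x \<in> E" using JE by blast
      define s where "s = 7 * r x / 2 ^ k"
      have s: "0 < s" "2 ^ k * s = 7 * r x" using r(1)[OF x] unfolding s_def by auto
      have "7 / 2 ^ k \<le> \<epsilon>" using k \<epsilon> by (simp add: field_simps)
      then have "s \<le> \<epsilon> * r x" using r(1)[OF x] mult_right_mono[of "7 / 2 ^ k" \<epsilon> "r x"] unfolding s_def by simp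
      have "measure m (ball (z x) (7 * r x)) \<le> C ^ k * measure m (ball (z x) s)"
        using doubling_iterate[of C R m s k "z x", OF _ doubl] s r(2)[OF x] C by simp
      also have "\<dots> \<le> C ^ k * measure m (ball (z x) (\<epsilon> * r x))"
        using C \<open>s \<le> \<epsilon> * r x\<close>
        by (intro mult_left_mono finite_measure_mono subset_ball) (auto intro!: sets_m)
      finally show "measure m (ball (z x) (7 * r x)) \<le> C ^ k * measure m (ball (z x) (\<epsilon> * r x))" .
    qed
    also have "\<dots> = C ^ k * (\<Sum>x\<in>J. measure m (ball (z x) (\<epsilon> * r x)))"
      by (simp add: sum_distrib_left)
    also have "(\<Sum>x\<in>J. measure m (ball (z x) (\<epsilon> * r x))) = measure m (\<Union>x\<in>J. ball (z x) (\<epsilon> * r x))"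
    proof (intro finite_measure_finite_Union[symmetric] fJ)
      show "disjoint_family_on (\<lambda>x. ball (z x) (\<epsilon> * r x)) J"
        by (rule disjoint_family_on_bisimulation[OF J(2)]) (use hole JE in blast)
    qed (auto intro!: sets_m)
    also have "\<dots> \<le> measure m (U - E)"
    proof (intro finite_measure_mono)
      show "(\<Union>x\<in>J. ball (z x) (\<epsilon> * r x)) \<subseteq> U - E" using hole JE by blast
      show "U - E \<in> sets m" using U(2) E_sets by (intro sets.Diff) (simp_all add: sets_m)
    qed
    also note UE
    finally show ?thesis using C by simp
  qed
  note bound = this
  have "measure m E \<le> 0"
  proof (rule field_le_epsilon)
    fix e :: real assume "0 < e"
    with bound[of "e / C ^ k"] C show "measure m E \<le> 0 + e" by simp
  qed
  then show ?thesis by (simp add: emeasure_eq_measure measure_le_0_iff)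
qed

text \<open>The exceptional points are those where, for some \<epsilon>, K has holes of relative
  size \<epsilon> at arbitrarily small scales. Countably many \<epsilon> suffice, and inner
  regularity reduces each set \<open>P n\<close> to its compact subsets: a hole of K is also a hole
  of any subset of K.\<close>

lemma AE_not_porous:
  fixes m :: "'a::polish_space measure"
  assumes m: "sets m = sets borel" "finite_measure m" "doubling m" and K: "compact K"
  shows "AE x in m. x \<in> K \<longrightarrow>
    (\<forall>\<epsilon>>0. \<exists>r0>0. \<forall>r z. 0 < r \<longrightarrow> r < r0 \<longrightarrow> dist x z < r \<longrightarrow> ball z (\<epsilon> * r) \<inter> K \<noteq> {})"
proof -
  interpret finite_measure m by fact
  have fin: "emeasure m (space m) \<noteq> \<infinity>" by simp
  define a where "a n = inverse (real (Suc n))" for n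
  have a: "0 < a n" for n unfolding a_def by simp
  have a_less: "\<exists>n. a n < e" if "0 < e" for e
    unfolding a_def using reals_Archimedean[OF that] by blast
  \<comment> \<open>Written as a union of open balls about the hole centres, \<open>H n k\<close> is
    visibly open, which makes \<open>P n\<close> Borel.\<close>
  define H where "H n k = (\<Union>r\<in>{0<..<a k}. \<Union>z\<in>{z. ball z (a n * r) \<inter> K = {}}. ball z r)" for n k
  have H_iff: "x \<in> H n k \<longleftrightarrow> (\<exists>r z. 0 < r \<and> r < a k \<and> dist x z < r \<and> ball z (a n * r) \<inter> K = {})"
    for x n k
    unfolding H_def by (force simp: dist_commute)
  have H_open: "open (H n k)" for n k
    unfolding H_def by (intro open_UN ballI open_ball)
  define P where "P n = K \<inter> (\<Inter>k. H n k)" for n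
  have P_sets: "P n \<in> sets borel" for n
    unfolding P_def using borel_compact[OF K] borel_open[OF H_open]
    by (intro sets.Int sets.countable_INT) auto
  have "emeasure m (P n) = 0" for n
  proof -
    have "emeasure m E = 0" if E: "compact E" "E \<subseteq> P n" for E
    proof (rule porous_compact_null[OF m E(1)])
      show "0 < a n" by (rule a)
      fix x and r0 :: real assume "x \<in> E" "0 < r0"
      then obtain k where k: "a k < r0" using a_less by blast
      have "E \<subseteq> K" "x \<in> H n k" using E \<open>x \<in> E\<close> unfolding P_def by auto
      then show "\<exists>r z. 0 < r \<and> r < r0 \<and> dist x z < r \<and> ball z (a n * r) \<inter> E = {}"
        unfolding H_iff using k by (meson disjoint_iff less_trans subsetD)
    qed
    then show ?thesis
      unfolding inner_regular[OF m(1) fin P_sets]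
      by (intro antisym SUP_least) auto
  qed
  then have "AE x in m. x \<notin> P n" for n
    using P_sets m(1) by (intro AE_not_in) auto
  then have "AE x in m. \<forall>n. x \<notin> P n" by (simp add: AE_all_countable)
  then show ?thesis
  proof (rule AE_mp, intro AE_I2 impI allI)
    fix x and \<epsilon> :: real assume x: "\<forall>n. x \<notin> P n" "x \<in> K" "0 < \<epsilon>"
    obtain n where n: "a n < \<epsilon>" using a_less[OF x(3)] by blast
    have "x \<notin> P n" using x(1) by blast
    then obtain k where k: "x \<notin> H n k" using x(2) unfolding P_def by blast
    have "ball z (\<epsilon> * r) \<inter> K \<noteq> {}" if "0 < r" "r < a k" "dist x z < r" for r z
    proof -
      have "ball z (a n * r) \<subseteq> ball z (\<epsilon> * r)"
        using n that by (intro subset_ball mult_right_mono) auto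
      moreover have "ball z (a n * r) \<inter> K \<noteq> {}" using k that unfolding H_iff by blast
      ultimately show ?thesis by blast
    qed
    then show "\<exists>r0>0. \<forall>r z. 0 < r \<longrightarrow> r < r0 \<longrightarrow> dist x z < r \<longrightarrow> ball z (\<epsilon> * r) \<inter> K \<noteq> {}"
      using a[of k] by blast
  qed
qed

section \<open>Difference quotients of Kantorovich potentials\<close>

text \<open>\<phi> is an infimum of functions \<open>d(\<cdot>,z)^2 / 2 - \<psi>(z)\<close>. By
  factoring the difference of squares, each is Lipschitz with constant \<open>D\<close>, uniformly
  in \<open>z\<close>, and the infimum inherits this.\<close>

lemma c_concave_Lipschitz:
  fixes \<phi> :: "'a::metric_space \<Rightarrow> ereal"
  assumes "c_concave \<phi>" and fin: "\<And>x. \<bar>\<phi> x\<bar> \<noteq> \<infinity>" and D: "\<And>x y :: 'a. dist x y \<le> D"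
  shows "real_of_ereal (\<phi> x) - real_of_ereal (\<phi> y) \<le> D * dist x y"
proof -
  obtain \<psi> where \<phi>: "\<phi> = c_transform \<psi>"
    using assms(1) unfolding c_concave_def by blast
  have "\<phi> x - ereal (D * dist x y) \<le> ereal ((dist y z)\<^sup>2 / 2) - \<psi> z" for z
  proof -
    have "(dist x z)\<^sup>2 - (dist y z)\<^sup>2 = (dist x z - dist y z) * (dist x z + dist y z)"
      by (simp add: power2_eq_square algebra_simps)
    also have "\<dots> \<le> dist x y * (dist x z + dist y z)"
      using dist_triangle[of x z y] by (intro mult_right_mono) auto
    also have "\<dots> \<le> dist x y * (2 * D)"
      using D[of x z] D[of y z] by (intro mult_left_mono) auto
    finally have *: "(dist x z)\<^sup>2 / 2 \<le> (dist y z)\<^sup>2 / 2 + D * dist x y"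
      by (simp add: mult.commute mult.left_commute)
    have "\<phi> x \<le> ereal ((dist x z)\<^sup>2 / 2) - \<psi> z"
      unfolding \<phi> c_transform_def by (intro INF_lower) simp
    then show ?thesis
      using * fin[of x] by (cases "\<psi> z"; cases "\<phi> x") auto
  qed
  then have "\<phi> x - ereal (D * dist x y) \<le> \<phi> y"
    unfolding \<phi> c_transform_def[of \<psi> y] by (intro INF_greatest)
  then show ?thesis
    using fin[of x] fin[of y] by (cases "\<phi> x"; cases "\<phi> y") auto
qed

text \<open>The infimum defining the transform at \<open>y\<close> is attained at \<open>x\<close>
  by the assumed equality, and \<open>z\<close> is a competitor. Both bounds on the difference
  quotient come from this inequality.\<close>

lemma c_superdifferential_ineq:
  fixes \<phi> :: "'a::metric_space \<Rightarrow> ereal"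
  assumes fin: "\<And>x. \<bar>\<phi> x\<bar> \<noteq> \<infinity>"
    and eq: "\<phi> x + c_transform \<phi> y = ereal ((dist x y)\<^sup>2 / 2)"
  shows "real_of_ereal (\<phi> z) - real_of_ereal (\<phi> x) \<le> ((dist z y)\<^sup>2 - (dist x y)\<^sup>2) / 2"
proof -
  have "c_transform \<phi> y \<le> ereal ((dist y z)\<^sup>2 / 2) - \<phi> z"
    unfolding c_transform_def by (intro INF_lower) simp
  then show ?thesis
    using eq fin[of x] fin[of z]
    by (cases "\<phi> x"; cases "\<phi> z"; cases "c_transform \<phi> y") (auto simp: dist_commute field_simps)
qed

text \<open>A continuous map from a compact set into a Hausdorff space is closed, hence a quotient
  map onto its image, so continuity of \<open>g\<close> can be tested after composing with
  \<open>p\<close>.\<close>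

lemma continuous_on_compact_image:
  fixes p :: "'a::t2_space \<Rightarrow> 'b::t2_space" and g :: "'b \<Rightarrow> 'c::topological_space"
  assumes C: "compact C" and p: "continuous_on C p" and gp: "continuous_on C (\<lambda>x. g (p x))"
  shows "continuous_on (p ` C) g"
proof -
  have closed_img: "closed (p ` C)"
    using C p by (intro compact_imp_closed compact_continuous_image)
  show ?thesis
    unfolding continuous_on_closed_vimage[OF closed_img]
  proof (intro allI impI)
    fix B :: "'c set" assume "closed B"
    then have "closed ((\<lambda>x. g (p x)) -` B \<inter> C)"
      using gp continuous_on_closed_vimage[OF compact_imp_closed[OF C]] by blast
    then have "compact (C \<inter> ((\<lambda>x. g (p x)) -` B \<inter> C))" by (rule compact_Int_closed[OF C])
    then have "compact (p ` (C \<inter> ((\<lambda>x. g (p x)) -` B \<inter> C)))"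
      by (rule compact_continuous_image[OF continuous_on_subset[OF p Int_lower1]])
    also have "p ` (C \<inter> ((\<lambda>x. g (p x)) -` B \<inter> C)) = g -` B \<inter> p ` C" by auto
    finally show "closed (g -` B \<inter> p ` C)" by (rule compact_imp_closed)
  qed
qed

lemma continuous_on_ev_geo:
  assumes "t \<in> {0..1}"
  shows "continuous_on S (ev t :: 'a::metric_space geo \<Rightarrow> 'a)"
  using dist_ev_le_dist_geo[OF assms]
  by (intro lipschitz_on_continuous_on[of 1] lipschitz_onI) auto

text \<open>This is the deterministic core, for one fixed geodesic: \<open>g\<close> records that
  length is a function of the starting point on \<open>C\<close>, and \<open>dense\<close> says that
  the set of starting points is not porous at that of \<gamma>.\<close>

lemma potential_quotient_tendsto:
  fixes \<phi> :: "'a::metric_space \<Rightarrow> ereal"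
  assumes fin: "\<And>x. \<bar>\<phi> x\<bar> \<noteq> \<infinity>" and L: "0 \<le> L"
    and lip: "\<And>x y. real_of_ereal (\<phi> x) - real_of_ereal (\<phi> y) \<le> L * dist x y"
    and C: "compact C"
    and eq: "\<And>\<eta>. \<eta> \<in> C \<Longrightarrow>
      \<phi> (ev 0 \<eta>) + c_transform \<phi> (ev 1 \<eta>) = ereal ((dist (ev 0 \<eta>) (ev 1 \<eta>))\<^sup>2 / 2)"
    and g: "\<And>\<eta>. \<eta> \<in> C \<Longrightarrow> g (ev 0 \<eta>) = dist (ev 0 \<eta>) (ev 1 \<eta>)"
    and \<gamma>: "\<gamma> \<in> C"
    and dense: "\<And>\<epsilon>. 0 < \<epsilon> \<Longrightarrow> \<exists>r0>0. \<forall>r z. 0 < r \<longrightarrow> r < r0 \<longrightarrow> dist (ev 0 \<gamma>) z < r \<longrightarrow>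
      ball z (\<epsilon> * r) \<inter> ev 0 ` C \<noteq> {}"
  shows "((\<lambda>t. (real_of_ereal (\<phi> (ev 0 \<gamma>)) - real_of_ereal (\<phi> (ev t \<gamma>))) / dist (ev 0 \<gamma>) (ev t \<gamma>))
      \<longlongrightarrow> dist (ev 0 \<gamma>) (ev 1 \<gamma>)) (at_right 0)"
proof -
  define f where "f x = real_of_ereal (\<phi> x)" for x
  define x where "x = ev 0 \<gamma>"
  define D where "D = dist x (ev 1 \<gamma>)"
  have dist_x: "dist x (ev t \<gamma>) = t * D" if "t \<in> {0..1}" for t
    using that dist_ev[of 0 t \<gamma>] unfolding x_def D_def by simp
  have t01: "\<forall>\<^sub>F t in at_right (0::real). t \<in> {0<..<1}"
    using eventually_at_right_real[of 0 1] by simp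
  show ?thesis
  proof (cases "D = 0")
    case True
    \<comment> \<open>For constant \<gamma> the quotient is \<open>0 / 0\<close>, which is
      \<open>0\<close> in HOL, in agreement with the convention.\<close>
    have "((\<lambda>t. (f x - f (ev t \<gamma>)) / dist x (ev t \<gamma>)) \<longlongrightarrow> D) (at_right 0)"
      by (rule tendsto_eventually, rule eventually_mono[OF t01]) (simp add: dist_x True)
    then show ?thesis unfolding f_def x_def D_def .
  next
    case False
    then have D: "0 < D" unfolding D_def by simp
    have lower: "D * (1 - t / 2) \<le> (f x - f (ev t \<gamma>)) / dist x (ev t \<gamma>)" if t: "t \<in> {0<..<1}" for t
    proof -
      have "dist (ev t \<gamma>) (ev 1 \<gamma>) = (1 - t) * D"
        using t dist_ev[of t 1 \<gamma>] unfolding x_def D_def by simp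
      then have "f (ev t \<gamma>) - f x \<le> (((1 - t) * D)\<^sup>2 - D\<^sup>2) / 2"
        using c_superdifferential_ineq[OF fin eq[OF \<gamma>], of "ev t \<gamma>"]
        unfolding f_def x_def D_def by simp
      also have "\<dots> = - (D * (1 - t / 2) * (t * D))"
        by (simp add: power2_eq_square field_simps)
      finally show ?thesis
        using t D by (simp add: dist_x pos_le_divide_eq)
    qed
    have gcont: "continuous_on (ev 0 ` C) g"
    proof (rule continuous_on_compact_image[OF C])
      have "continuous_on C (\<lambda>\<eta>. dist (ev 0 \<eta>) (ev 1 \<eta>))"
        by (intro continuous_on_dist continuous_on_ev_geo) auto
      then show "continuous_on C (\<lambda>\<eta>. g (ev 0 \<eta>))"
        using g by (simp cong: continuous_on_cong)
    qed (auto intro: continuous_on_ev_geo)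
    have upper: "\<forall>\<^sub>F t in at_right 0. (f x - f (ev t \<gamma>)) / dist x (ev t \<gamma>)
        \<le> (1 + 2 * \<epsilon>) * (D + 2 * \<epsilon>) + 2 * L * \<epsilon>" if \<epsilon>: "0 < \<epsilon>" for \<epsilon>
    proof -
      have "x \<in> ev 0 ` C" "g x = D" using \<gamma> g unfolding x_def D_def by auto
      then obtain d where d: "0 < d" "\<And>z. z \<in> ev 0 ` C \<Longrightarrow> dist z x < d \<Longrightarrow> dist (g z) D < \<epsilon>"
        using gcont \<epsilon> unfolding continuous_on_iff by metis
      obtain r0 where r0: "0 < r0" "\<And>r z. 0 < r \<Longrightarrow> r < r0 \<Longrightarrow> dist x z < r \<Longrightarrow>
          ball z (\<epsilon> * r) \<inter> ev 0 ` C \<noteq> {}"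
        using dense[OF \<epsilon>] unfolding x_def by blast
      define A where "A = (1 + 2 * \<epsilon>) * D"
      have A: "0 < A" using D \<epsilon> unfolding A_def by simp
      \<comment> \<open>The four bounds ensure, in order, that \<open>t < 1\<close>, that the radius
        \<open>2 * t * D\<close> is below \<open>r0\<close>, that the nearby starting point is
        within the continuity range \<open>d\<close> of \<open>x\<close>, and that half its distance
        to \<open>x\<close> is below \<epsilon>. Here \<open>t * A\<close> bounds that
        distance.\<close>
      define \<tau> where "\<tau> = min (min 1 (r0 / (2 * D))) (min (d / A) (2 * \<epsilon> / A))"
      have "0 < \<tau>" using r0 d A D \<epsilon> unfolding \<tau>_def by simp
      then have "\<forall>\<^sub>F t in at_right 0. t \<in> {0<..<\<tau>}" by (rule eventually_at_right_real)
      then show ?thesis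
      proof (rule eventually_mono)
        fix t assume t: "t \<in> {0<..<\<tau>}"
        then have t1: "0 < t" "t < 1" "2 * t * D < r0" "t * A < d" "t * A < 2 * \<epsilon>"
          using D A unfolding \<tau>_def by (auto simp: field_simps)
        have dt: "dist x (ev t \<gamma>) = t * D" using dist_x t1 by simp
        \<comment> \<open>Twice the distance \<open>t * D\<close> is taken as radius because
          \<open>dense\<close> asks for a strict inequality.\<close>
        then have "ball (ev t \<gamma>) (\<epsilon> * (2 * t * D)) \<inter> ev 0 ` C \<noteq> {}"
          using t1 D by (intro r0) auto
        then obtain \<eta> where \<eta>: "\<eta> \<in> C" "dist (ev t \<gamma>) (ev 0 \<eta>) < 2 * \<epsilon> * (t * D)"
          by (auto simp: mult_ac)
        define z where "z = ev 0 \<eta>"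
        define G where "G = dist z (ev 1 \<eta>)"
        have xz: "dist x z \<le> t * A"
          using dist_triangle[of x z "ev t \<gamma>"] dt \<eta>(2) unfolding A_def z_def
          by (simp add: algebra_simps)
        have "g z = G" using g[OF \<eta>(1)] unfolding z_def G_def .
        then have G: "G \<le> D + \<epsilon>"
          using d(2)[of z] \<eta>(1) xz t1 unfolding z_def by (auto simp: dist_commute dist_real_def)
        \<comment> \<open>The comparison now runs through the end point of \<eta>, whose length
          \<open>G\<close> is close to \<open>D\<close> by continuity of \<open>g\<close>.\<close>
        have "f x - f z \<le> ((dist x (ev 1 \<eta>))\<^sup>2 - G\<^sup>2) / 2"
          using c_superdifferential_ineq[OF fin eq[OF \<eta>(1)], of x] unfolding f_def z_def G_def .
        also have "\<dots> \<le> ((dist x z + G)\<^sup>2 - G\<^sup>2) / 2"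
          using dist_triangle[of x "ev 1 \<eta>" z] unfolding G_def
          by (intro divide_right_mono diff_right_mono power_mono) auto
        also have "\<dots> = dist x z * (G + dist x z / 2)"
          by (simp add: power2_eq_square field_simps)
        also have "\<dots> \<le> (t * A) * (D + 2 * \<epsilon>)"
          using xz G t1 A by (intro mult_mono) (auto simp: G_def)
        finally have "f x - f z \<le> (t * A) * (D + 2 * \<epsilon>)" .
        moreover have "f z - f (ev t \<gamma>) \<le> L * (2 * \<epsilon> * (t * D))"
        proof -
          have "f z - f (ev t \<gamma>) \<le> L * dist z (ev t \<gamma>)" unfolding f_def by (rule lip)
          also have "\<dots> \<le> L * (2 * \<epsilon> * (t * D))"
            using \<eta>(2) L unfolding z_def by (intro mult_left_mono) (auto simp: dist_commute)
          finally show ?thesis .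
        qed
        ultimately have "f x - f (ev t \<gamma>) \<le> ((1 + 2 * \<epsilon>) * (D + 2 * \<epsilon>) + 2 * L * \<epsilon>) * (t * D)"
          unfolding A_def by (simp add: algebra_simps)
        then show "(f x - f (ev t \<gamma>)) / dist x (ev t \<gamma>) \<le> (1 + 2 * \<epsilon>) * (D + 2 * \<epsilon>) + 2 * L * \<epsilon>"
          using t1 D unfolding dt by (simp add: pos_divide_le_eq)
      qed
    qed
    have "((\<lambda>t. (f x - f (ev t \<gamma>)) / dist x (ev t \<gamma>)) \<longlongrightarrow> D) (at_right 0)"
    proof (rule order_tendstoI)
      fix a assume "a < D"
      have "((\<lambda>t. D * (1 - t / 2)) \<longlongrightarrow> D * (1 - 0 / 2)) (at_right 0)"
        by (intro tendsto_intros) auto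
      then have "\<forall>\<^sub>F t in at_right 0. a < D * (1 - t / 2)"
        using \<open>a < D\<close> by (intro order_tendstoD(1)) auto
      with t01 show "\<forall>\<^sub>F t in at_right 0. a < (f x - f (ev t \<gamma>)) / dist x (ev t \<gamma>)"
        by eventually_elim (rule less_le_trans[OF _ lower])
    next
      fix a assume "D < a"
      have "((\<lambda>\<epsilon>. (1 + 2 * \<epsilon>) * (D + 2 * \<epsilon>) + 2 * L * \<epsilon>) \<longlongrightarrow> (1 + 2 * 0) * (D + 2 * 0) + 2 * L * 0)
          (at_right 0)"
        by (intro tendsto_intros)
      then have "\<forall>\<^sub>F \<epsilon> in at_right 0. (1 + 2 * \<epsilon>) * (D + 2 * \<epsilon>) + 2 * L * \<epsilon> < a"
        using \<open>D < a\<close> by (intro order_tendstoD(2)) auto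
      then have "\<forall>\<^sub>F \<epsilon> in at_right 0. \<epsilon> \<in> {0<..<1} \<and> (1 + 2 * \<epsilon>) * (D + 2 * \<epsilon>) + 2 * L * \<epsilon> < a"
        using t01 by (simp add: eventually_conj_iff)
      from eventually_happens'[OF trivial_limit_at_right_real this]
      obtain \<epsilon> where "0 < \<epsilon>" "(1 + 2 * \<epsilon>) * (D + 2 * \<epsilon>) + 2 * L * \<epsilon> < a"
        by auto
      then show "\<forall>\<^sub>F t in at_right 0. (f x - f (ev t \<gamma>)) / dist x (ev t \<gamma>) < a"
        by (intro eventually_mono[OF upper[of \<epsilon>]]) auto
    qed
    then show ?thesis unfolding f_def x_def D_def .
  qed
qed

section \<open>From compact sets of geodesics to \<pi>-almost every geodesic\<close>

lemma AE_compact_exhaustion: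
  fixes M :: "'a::polish_space measure"
  assumes M: "sets M = sets borel" "finite_measure M" and P: "AE x in M. P x"
  shows "\<exists>C :: nat \<Rightarrow> 'a set. (\<forall>n. compact (C n)) \<and> (\<forall>n. \<forall>x\<in>C n. P x) \<and> (AE x in M. \<exists>n. x \<in> C n)"
proof -
  interpret finite_measure M by fact
  have fin: "emeasure M (space M) \<noteq> \<infinity>" by simp
  have space_M: "space M = UNIV" using sets_eq_imp_space_eq[OF M(1)] by simp
  obtain N where N: "{x \<in> space M. \<not> P x} \<subseteq> N" "N \<in> sets M" "emeasure M N = 0"
    using P by (rule AE_E)
  \<comment> \<open>\<open>P\<close> may fail to be measurable, so inner regularity is applied to
    the complement of a measurable null set containing all its failures.\<close>
  define A where "A = - N"
  have A: "A \<in> sets M" "A \<in> sets borel"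
    using N(2) M(1) unfolding A_def by auto
  have "\<exists>K. K \<subseteq> A \<and> compact K \<and> measure M A - inverse (real (Suc n)) < measure M K" for n
  \<comment> \<open>A negative target would be truncated to \<open>0\<close> by
    \<open>ennreal\<close>, and the strict inequality could fail; then the empty set serves.\<close>
  proof (cases "measure M A - inverse (real (Suc n)) < 0")
    case True
    then show ?thesis by (intro exI[of _ "{}"]) auto
  next
    case False
    have "ennreal (measure M A - inverse (real (Suc n))) < emeasure M A"
      using False by (simp add: emeasure_eq_measure ennreal_less_iff)
    then obtain K where "K \<subseteq> A" "compact K"
        "ennreal (measure M A - inverse (real (Suc n))) < emeasure M K"
      unfolding inner_regular[OF M(1) fin A(2)] less_SUP_iff by blast
    with False show ?thesis
      by (auto simp: emeasure_eq_measure ennreal_less_iff)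
  qed
  then obtain C where C: "\<And>n. C n \<subseteq> A" "\<And>n. compact (C n)"
      "\<And>n. measure M A - inverse (real (Suc n)) < measure M (C n)" by metis
  have C_sets: "C n \<in> sets M" for n using C(2) M(1) by (simp add: borel_compact)
  define U where "U = (\<Union>n. C n)"
  have U: "U \<in> sets M" "U \<subseteq> A" using C C_sets unfolding U_def by auto
  have "measure M A \<le> measure M U"
  proof (rule field_le_epsilon)
    fix e :: real assume "0 < e"
    then obtain n where "inverse (real (Suc n)) < e" using reals_Archimedean by blast
    moreover have "measure M (C n) \<le> measure M U"
      using U by (intro finite_measure_mono) (auto simp: U_def)
    ultimately show "measure M A \<le> measure M U + e" using C(3)[of n] by linarith
  qed
  then have "measure M (A - U) = 0"
    using finite_measure_Diff[OF A(1) U] finite_measure_mono[OF U(2) A(1)] by simp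
  then have "AE x in M. x \<notin> A - U"
    using A U by (intro AE_not_in) (auto simp: null_sets_def emeasure_eq_measure)
  moreover have "AE x in M. x \<notin> N" using N by (intro AE_not_in) auto
  ultimately have "AE x in M. \<exists>n. x \<in> C n"
    by eventually_elim (auto simp: A_def U_def)
  moreover have "P x" if "x \<in> C n" for x n
    using that C(1)[of n] N(1) unfolding A_def space_M by blast
  ultimately show ?thesis using C(2) by blast
qed

theorem theorem4p5:
  fixes m \<mu> \<nu> :: "'a::polish_space measure"
    and \<rho> :: "'a \<Rightarrow> real"
    and \<pi> :: "'a geo measure"
    and \<phi> :: "'a \<Rightarrow> ereal"
    and sbar :: real
  assumes bdd: "bounded (UNIV :: 'a set)"
    and m: "boundedly_finite_borel m" "doubling m"
    and \<mu>: "\<mu> \<in> borel_prob"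
    and \<rho>: "\<rho> \<in> borel_measurable m" "\<mu> = density m (\<lambda>x. ennreal (\<rho> x))" "AE x in m. \<rho> x > 0"
    and \<nu>: "\<nu> \<in> borel_prob"
    and \<pi>: "\<pi> \<in> GeoOpt \<mu> \<nu>"
    and \<phi>: "kantorovich_potential \<pi> \<phi>"
    and slope: "AE \<gamma> in \<pi>. asc_slope_geo (\<lambda>x. real_of_ereal (\<phi> x)) (ev 0 \<gamma>)
                  = ennreal (dist (ev 0 \<gamma>) (ev 1 \<gamma>))"
    and sbar: "0 < sbar" "sbar \<le> 1"
    and ac: "\<And>s. 0 \<le> s \<Longrightarrow> s < sbar \<Longrightarrow> absolutely_continuous m (distr \<pi> borel (ev s))"
  shows "AE \<gamma> in \<pi>.
           ((\<lambda>t. (real_of_ereal (\<phi> (ev 0 \<gamma>)) - real_of_ereal (\<phi> (ev t \<gamma>)))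
                   / dist (ev 0 \<gamma>) (ev t \<gamma>))
              \<longlongrightarrow> dist (ev 0 \<gamma>) (ev 1 \<gamma>)) (at_right 0)"
proof -
  have sets_\<pi>: "sets \<pi> = sets borel" and prob_\<pi>: "prob_space \<pi>"
    using \<pi> unfolding GeoOpt_def borel_prob_def by auto
  interpret P: prob_space \<pi> by fact
  have sets_m: "sets m = sets borel" and "emeasure m UNIV < \<infinity>"
    using m(1) bdd unfolding boundedly_finite_borel_def by auto
  then have fin_m: "finite_measure m"
    using sets_eq_imp_space_eq[OF sets_m] by (intro finite_measureI) auto
  have fin: "\<bar>\<phi> x\<bar> \<noteq> \<infinity>" for x
    using kantorovich_potential_real_valued[OF bdd prob_\<pi> \<phi>] .
  obtain D where D: "\<And>x y :: 'a. dist x y \<le> D"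
    using bdd unfolding bounded_two_points by blast
  have "0 \<le> D" using D[of undefined undefined] by simp
  have "c_concave \<phi>" using \<phi> unfolding kantorovich_potential_def by blast
  then have lip: "real_of_ereal (\<phi> x) - real_of_ereal (\<phi> y) \<le> D * dist x y" for x y
    by (rule c_concave_Lipschitz[OF _ fin D])
  define good where "good \<gamma> \<longleftrightarrow>
      \<phi> (ev 0 \<gamma>) + c_transform \<phi> (ev 1 \<gamma>) = ereal ((dist (ev 0 \<gamma>) (ev 1 \<gamma>))\<^sup>2 / 2) \<and>
      asc_slope_geo (\<lambda>x. real_of_ereal (\<phi> x)) (ev 0 \<gamma>) = ennreal (dist (ev 0 \<gamma>) (ev 1 \<gamma>))" for \<gamma>
  have AE_good: "AE \<gamma> in \<pi>. good \<gamma>"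
    using \<phi> slope unfolding kantorovich_potential_def good_def by simp
  obtain C where C: "\<And>n. compact (C n)" "\<And>n \<gamma>. \<gamma> \<in> C n \<Longrightarrow> good \<gamma>"
      and AE_C: "AE \<gamma> in \<pi>. \<exists>n::nat. \<gamma> \<in> C n"
    using AE_compact_exhaustion[OF sets_\<pi> P.finite_measure_axioms AE_good] by blast
  have meas: "ev 0 \<in> measurable \<pi> borel"
    unfolding measurable_cong_sets[OF sets_\<pi> refl] by (rule borel_measurable_ev) simp
  have "AE x in distr \<pi> borel (ev 0). x \<in> ev 0 ` C n \<longrightarrow>
      (\<forall>\<epsilon>>0. \<exists>r0>0. \<forall>r z. 0 < r \<longrightarrow> r < r0 \<longrightarrow> dist x z < r \<longrightarrow> ball z (\<epsilon> * r) \<inter> ev 0 ` C n \<noteq> {})" for n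
  \<comment> \<open>Absolute continuity at time \<open>0\<close> carries the m-null exceptional set
    to the law of the starting point, and \<open>AE_distrD\<close> then pulls it back to
    \<pi>.\<close>
  proof (rule absolutely_continuous_AE[OF _ ac])
    show "AE x in m. x \<in> ev 0 ` C n \<longrightarrow>
      (\<forall>\<epsilon>>0. \<exists>r0>0. \<forall>r z. 0 < r \<longrightarrow> r < r0 \<longrightarrow> dist x z < r \<longrightarrow> ball z (\<epsilon> * r) \<inter> ev 0 ` C n \<noteq> {})"
      by (intro AE_not_porous sets_m fin_m m(2) compact_continuous_image continuous_on_ev_geo C) simp
  qed (use sets_m sbar in auto)
  then have "AE \<gamma> in \<pi>. ev 0 \<gamma> \<in> ev 0 ` C n \<longrightarrow>
      (\<forall>\<epsilon>>0. \<exists>r0>0. \<forall>r z. 0 < r \<longrightarrow> r < r0 \<longrightarrow> dist (ev 0 \<gamma>) z < r \<longrightarrow> ball z (\<epsilon> * r) \<inter> ev 0 ` C n \<noteq> {})" for n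
    by (rule AE_distrD[OF meas])
  then have "AE \<gamma> in \<pi>. \<forall>n. ev 0 \<gamma> \<in> ev 0 ` C n \<longrightarrow>
      (\<forall>\<epsilon>>0. \<exists>r0>0. \<forall>r z. 0 < r \<longrightarrow> r < r0 \<longrightarrow> dist (ev 0 \<gamma>) z < r \<longrightarrow> ball z (\<epsilon> * r) \<inter> ev 0 ` C n \<noteq> {})"
    by (simp only: AE_all_countable simp_thms)
  with AE_C show ?thesis
  proof eventually_elim
    case (elim \<gamma>)
    then obtain n where n: "\<gamma> \<in> C n" by blast
    \<comment> \<open>By \<open>good\<close>, the slope at the starting point equals the length for
      every geodesic in \<open>C n\<close>, so it is the required function on X.\<close>
    define g where "g x = enn2real (asc_slope_geo (\<lambda>x. real_of_ereal (\<phi> x)) x)" for x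
    show ?case
    proof (rule potential_quotient_tendsto[OF fin \<open>0 \<le> D\<close> lip C(1)[of n] _ _ n, where g = g])
      fix \<epsilon> :: real assume "0 < \<epsilon>"
      with elim(2) n show "\<exists>r0>0. \<forall>r z. 0 < r \<longrightarrow> r < r0 \<longrightarrow> dist (ev 0 \<gamma>) z < r \<longrightarrow>
          ball z (\<epsilon> * r) \<inter> ev 0 ` C n \<noteq> {}" by blast
    qed (use C(2) in \<open>auto simp: good_def g_def\<close>)
  qed
qed

end
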